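(* $[\mathcal{R}\mathbf{Txt}\mathbf{Td}\mathbf{CInd}\mathbf{Ex}_C]_{\mathbf{REC}} \setminus [\tau(\mathbf{CInd})\mathbf{Txt}\mathbf{G}\mathbf{Bc}_C]_{\mathbf{REC}} \neq \emptyset$.
   Context: Fix an acceptable numbering $(\varphi_e)_{e\in\mathbb{N}}$ of all partial computable functions. A number $e$ is a $C$-index if $\varphi_e$ is total with values in $\{0,1\}$; then $C_e=\{x:\varphi_e(x)=1\}$. $\mathbf{REC}$ is the collection of recursive subsets of $\mathbb{N}$; $\mathcal{P}$ and $\mathcal{R}$ are the partial computable and total computable functions. Fix a pause symbol $\#$. A text is a total function $T:\mathbb{N}\to\mathbb{N}\cup\{\#\}$, $\mathrm{content}(T)=\mathrm{range}(T)\setminus\{\#\}$, $T$ is a text for $L$ if $\mathrm{content}(T)=L$, $T[n]=(T(0),\dots,T(n-1))$. A learner is some $h\in\mathcal{P}$, which may output a special symbol "?" meaning "no new hypothesis". Hypothesis sequences: full-information $\mathbf{G}(h,T)(i)=h(T[i])$; transductive $\mathbf{Td}(h,T)(0)=?$, and for $i>0$, $\mathbf{Td}(h,T)(i)=\mathbf{Td}(h,T)(i-1)$ if $h(T(i-1))=?$, else $h(T(i-1))$. Restrictions on hypothesis sequence $p$ and text $T$: $\mathbf{Ex}_C$: there is $n_0$ with $p(n)=p(n_0)$ for all $n\ge n_0$ and $p(n_0)$ a $C$-index with $C_{p(n_0)}=\mathrm{content}(T)$; $\mathbf{Bc}_C$: there is $n_0$ such that for all $n\ge n_0$, $p(n)$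 is a $C$-index with $C_{p(n)}=\mathrm{content}(T)$; $\mathbf{CInd}$: for all $i$, $p(i)$ is a $C$-index. Juxtaposition means conjunction. For $\mathcal{C}\in\{\mathcal{P},\mathcal{R}\}$ (omitted means $\mathcal{P}$), $h\in\mathcal{C}$ $\tau(\alpha)\mathcal{C}\mathbf{Txt}\beta\delta$-learns $L$ iff $\alpha(\beta(h,T),T)$ holds for every text $T$ whatsoever (not only texts for $L$) and $\delta(\beta(h,T),T)$ holds for every text $T$ for $L$ (omitting $\tau(\alpha)$ means no such global requirement). $[\tau(\alpha)\mathcal{C}\mathbf{Txt}\beta\delta]_{\mathbf{REC}}$ is the set of all classes $\mathcal{L}\subseteq\mathbf{REC}$ for which some $h\in\mathcal{C}$ learns every $L\in\mathcal{L}$ in this sense.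
   Formalization: CInd is read as allowing "?": each p(i) must be "?" or a C-index. Read literally, no Td learner satisfies CInd, as Td(h,T)(0)=?, so the left side would hold only the empty class and the claim would fail. *)

theory Defs
  imports Main "HOL-Library.Nat_Bijection"
begin

section \<open>Partial computable functions\<close>

text \<open>
  The \<open>\<mu>\<close>-recursive functions. \<^term>\<open>None\<close> means ``undefined''. An \<open>n\<close>-ary partial function is
  represented by a function on lists of which only the values on lists of length \<open>n\<close> matter;
  the last rule closes the predicate under changes on lists of other lengths.
\<close>

inductive partrec :: "nat \<Rightarrow> (nat list \<Rightarrow> nat option) \<Rightarrow> bool" where
  zero: "partrec n (\<lambda>xs. Some 0)"
| succ: "partrec 1 (\<lambda>xs. Some (Suc (xs ! 0)))"
| proj: "i < n \<Longrightarrow> partrec n (\<lambda>xs. Some (xs ! i))"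
| comp: "partrec (length gs) f \<Longrightarrow> (\<And>g. g \<in> set gs \<Longrightarrow> partrec n g) \<Longrightarrow>
    partrec n (\<lambda>xs. if \<exists>g\<in>set gs. g xs = None then None else f (map (\<lambda>g. the (g xs)) gs))"
| prim: "partrec n f \<Longrightarrow> partrec (n + 2) g \<Longrightarrow>
    partrec (n + 1) (\<lambda>xs. rec_nat (f (tl xs))
      (\<lambda>k r. case r of None \<Rightarrow> None | Some v \<Rightarrow> g (k # v # tl xs)) (hd xs))"
| mu: "partrec (n + 1) f \<Longrightarrow>
    partrec n (\<lambda>xs. if \<exists>k. f (k # xs) = Some 0 \<and> (\<forall>j<k. f (j # xs) \<noteq> None)
      then Some (LEAST k. f (k # xs) = Some 0) else None)"
| cong: "partrec n f \<Longrightarrow> (\<And>xs. length xs = n \<Longrightarrow> f xs = g xs) \<Longrightarrow> partrec n g"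

definition partial_computable :: "(nat \<rightharpoonup> nat) set" ("\<P>") where
  "\<P> = {f. partrec 1 (\<lambda>xs. f (xs ! 0))}"

definition total_computable :: "(nat \<rightharpoonup> nat) set" ("\<R>") where
  "\<R> = {f \<in> \<P>. \<forall>x. f x \<noteq> None}"

definition REC :: "nat set set" where
  "REC = {A. (\<lambda>x. Some (if x \<in> A then 1 else 0)) \<in> \<R>}"

text \<open>
  Acceptability in the sense of Rogers: \<open>\<phi>\<close> enumerates exactly the unary partial computable
  functions, has a partial computable universal function, and every uniformly computable
  sequence of partial functions can be translated computably into \<open>\<phi>\<close>-indices.
\<close>

definition acceptable_numbering :: "(nat \<Rightarrow> nat \<rightharpoonup> nat) \<Rightarrow> bool" where
  "acceptable_numbering \<phi> \<longleftrightarrow>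
     range \<phi> = \<P> \<and>
     partrec 2 (\<lambda>xs. \<phi> (xs ! 0) (xs ! 1)) \<and>
     (\<forall>\<psi>. partrec 2 (\<lambda>xs. \<psi> (xs ! 0) (xs ! 1)) \<longrightarrow>
        (\<exists>c. (\<lambda>e. Some (c e)) \<in> \<R> \<and> (\<forall>e. \<phi> (c e) = \<psi> e)))"

definition C_index :: "(nat \<Rightarrow> nat \<rightharpoonup> nat) \<Rightarrow> nat \<Rightarrow> bool" where
  "C_index \<phi> e \<longleftrightarrow> (\<forall>x. \<phi> e x = Some 0 \<or> \<phi> e x = Some 1)"

definition C_set :: "(nat \<Rightarrow> nat \<rightharpoonup> nat) \<Rightarrow> nat \<Rightarrow> nat set" where
  "C_set \<phi> e = {x. \<phi> e x = Some 1}"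


section \<open>Texts and learners\<close>

datatype symbol = Pause | Datum nat

type_synonym text_seq = "nat \<Rightarrow> symbol"

definition content :: "text_seq \<Rightarrow> nat set" where
  "content T = {x. Datum x \<in> range T}"

definition text_for :: "text_seq \<Rightarrow> nat set \<Rightarrow> bool" where
  "text_for T L \<longleftrightarrow> content T = L"

definition initial_segment :: "text_seq \<Rightarrow> nat \<Rightarrow> symbol list" where
  "initial_segment T n = map T [0..<n]"

datatype hypothesis = No_New_Hypothesis | Hypothesis nat

text \<open>
  Learners are partial computable functions on \<^typ>\<open>nat\<close>; their inputs (symbols, or finite
  sequences of symbols) and their outputs (hypotheses, including ``?'') are encoded bijectively
  by natural numbers.
\<close>

fun symbol_encode :: "symbol \<Rightarrow> nat" where
  "symbol_encode Pause = 0"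
| "symbol_encode (Datum x) = Suc x"

definition sequence_encode :: "symbol list \<Rightarrow> nat" where
  "sequence_encode \<sigma> = list_encode (map symbol_encode \<sigma>)"

fun hypothesis_decode :: "nat \<Rightarrow> hypothesis" where
  "hypothesis_decode 0 = No_New_Hypothesis"
| "hypothesis_decode (Suc e) = Hypothesis e"

type_synonym learner = "nat \<rightharpoonup> nat"

text \<open>The hypothesis at position \<open>i\<close> is \<^term>\<open>None\<close> if the learner diverges there.\<close>

type_synonym hyp_seq = "nat \<Rightarrow> hypothesis option"

definition G :: "learner \<Rightarrow> text_seq \<Rightarrow> hyp_seq" where
  "G h T i = map_option hypothesis_decode (h (sequence_encode (initial_segment T i)))"

fun Td :: "learner \<Rightarrow> text_seq \<Rightarrow> hyp_seq" where
  "Td h T 0 = Some No_New_Hypothesis"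
| "Td h T (Suc i) =
     (let r = map_option hypothesis_decode (h (symbol_encode (T i)))
      in if r = Some No_New_Hypothesis then Td h T i else r)"


section \<open>Learning criteria\<close>

type_synonym restriction = "hyp_seq \<Rightarrow> text_seq \<Rightarrow> bool"

definition Ex_C :: "(nat \<Rightarrow> nat \<rightharpoonup> nat) \<Rightarrow> restriction" where
  "Ex_C \<phi> p T \<longleftrightarrow> (\<exists>n\<^sub>0. (\<forall>n\<ge>n\<^sub>0. p n = p n\<^sub>0) \<and>
     (\<exists>e. p n\<^sub>0 = Some (Hypothesis e) \<and> C_index \<phi> e \<and> C_set \<phi> e = content T))"

definition Bc_C :: "(nat \<Rightarrow> nat \<rightharpoonup> nat) \<Rightarrow> restriction" where
  "Bc_C \<phi> p T \<longleftrightarrow> (\<exists>n\<^sub>0. \<forall>n\<ge>n\<^sub>0.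
     \<exists>e. p n = Some (Hypothesis e) \<and> C_index \<phi> e \<and> C_set \<phi> e = content T)"

text \<open>
  Every hypothesis output is a \<open>C\<close>-index. The symbol ``?'' is not a hypothesis and does not violate
  the restriction (otherwise no transductive learner could ever satisfy it, since
  \<^term>\<open>Td h T 0\<close> is ``?''); divergence does violate it.
\<close>

definition CInd :: "(nat \<Rightarrow> nat \<rightharpoonup> nat) \<Rightarrow> restriction" where
  "CInd \<phi> p T \<longleftrightarrow> (\<forall>i. p i = Some No_New_Hypothesis \<or>
     (\<exists>e. p i = Some (Hypothesis e) \<and> C_index \<phi> e))"

definition unrestricted :: restriction where
  "unrestricted p T \<longleftrightarrow> True"

definition restriction_conj :: "restriction \<Rightarrow> restriction \<Rightarrow> restriction" (infixr "\<sqinter>\<^sub>r" 70) where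
  "(\<delta> \<sqinter>\<^sub>r \<delta>') p T \<longleftrightarrow> \<delta> p T \<and> \<delta>' p T"

text \<open>
  \<open>learns \<alpha> \<beta> \<delta> h L\<close>: \<open>h\<close> learns \<open>L\<close> with interaction operator \<open>\<beta>\<close> and restriction \<open>\<delta>\<close> on the
  texts for \<open>L\<close>, and with the global restriction \<open>\<alpha>\<close> on all texts.
  \<open>learnable_classes \<alpha> \<C> \<beta> \<delta>\<close> is \<open>[\<tau>(\<alpha>)\<C>Txt\<beta>\<delta>]\<^bsub>REC\<^esub>\<close>.
\<close>

definition learns ::
  "restriction \<Rightarrow> (learner \<Rightarrow> text_seq \<Rightarrow> hyp_seq) \<Rightarrow> restriction \<Rightarrow> learner \<Rightarrow> nat set \<Rightarrow> bool" where
  "learns \<alpha> \<beta> \<delta> h L \<longleftrightarrow>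
     (\<forall>T. \<alpha> (\<beta> h T) T) \<and> (\<forall>T. text_for T L \<longrightarrow> \<delta> (\<beta> h T) T)"

definition learnable_classes ::
  "restriction \<Rightarrow> learner set \<Rightarrow> (learner \<Rightarrow> text_seq \<Rightarrow> hyp_seq) \<Rightarrow> restriction \<Rightarrow> nat set set set" where
  "learnable_classes \<alpha> \<C> \<beta> \<delta> = {\<L>. \<L> \<subseteq> REC \<and> (\<exists>h\<in>\<C>. \<forall>L\<in>\<L>. learns \<alpha> \<beta> \<delta> h L)}"

end

theory Submission
  imports Defs
begin

text \<open>
  The class consists of the nonempty sets \<open>C\<^sub>e\<close> all of whose elements are pairs with first
  component \<open>e\<close>, so that every datum discloses a correct index. Against a learner \<open>h\<close> all of whose
  hypotheses are \<open>C\<close>-indices, the text \<open>T\<close> with \<open>T(0) = (e,0)\<close> and, for \<open>n > 0\<close>, \<open>T(n) = #\<close> if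
  \<open>h(T[n])\<close> is a hypothesis whose set contains \<open>(e,n)\<close> and \<open>T(n) = (e,n)\<close> otherwise, is computable
  uniformly in \<open>e\<close>, and every hypothesis after the first is wrong about \<open>(e,n)\<close>. By the recursion
  theorem \<open>e\<close> can be chosen to be a \<open>C\<close>-index of the content of its own text, which puts that
  content into the class.
\<close>

section \<open>Total computable functions\<close>

definition total_rec :: "nat \<Rightarrow> (nat list \<Rightarrow> nat) \<Rightarrow> bool" where
  "total_rec n f \<longleftrightarrow> partrec n (\<lambda>xs. Some (f xs))"

lemma total_rec_cong:
  assumes "total_rec n f" "\<And>xs. length xs = n \<Longrightarrow> f xs = g xs"
  shows "total_rec n g"
  using assms partrec.cong[of n "\<lambda>xs. Some (f xs)" "\<lambda>xs. Some (g xs)"] by (simp add: total_rec_def)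

text \<open>Total inner functions make the divergence guard of \<open>partrec.comp\<close> vacuous;
  the outer \<open>f\<close> may stay partial, as when \<phi> is applied to computed
  arguments.\<close>

lemma partrec_comp_total:
  assumes "partrec (length gs) f" "\<And>g. g \<in> set gs \<Longrightarrow> total_rec n g"
  shows "partrec n (\<lambda>xs. f (map (\<lambda>g. g xs) gs))"
proof -
  let ?gs = "map (\<lambda>g xs. Some (g xs)) gs"
  have "partrec n (\<lambda>xs. if \<exists>g\<in>set ?gs. g xs = None then None else f (map (\<lambda>g. the (g xs)) ?gs))"
    by (rule partrec.comp) (use assms in \<open>auto simp: total_rec_def\<close>)
  then show ?thesis
    by (rule partrec.cong) (auto simp: comp_def)
qed

lemma total_rec_comp:
  assumes "total_rec (length gs) f" "\<And>g. g \<in> set gs \<Longrightarrow> total_rec n g"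
  shows "total_rec n (\<lambda>xs. f (map (\<lambda>g. g xs) gs))"
  using partrec_comp_total[of gs "\<lambda>xs. Some (f xs)" n] assms by (simp add: total_rec_def)

lemma total_rec_nth: "i < n \<Longrightarrow> total_rec n (\<lambda>xs. xs ! i)"
  by (simp add: total_rec_def partrec.proj)

lemma total_rec_comp1:
  assumes "total_rec 1 (\<lambda>xs. f (xs ! 0))" "total_rec n a"
  shows "total_rec n (\<lambda>xs. f (a xs))"
  using total_rec_comp[of "[a]" "\<lambda>xs. f (xs ! 0)" n] assms by simp

lemma total_rec_comp2:
  assumes "total_rec 2 (\<lambda>xs. f (xs ! 0) (xs ! 1))" "total_rec n a" "total_rec n b"
  shows "total_rec n (\<lambda>xs. f (a xs) (b xs))"
  using total_rec_comp[of "[a, b]" "\<lambda>xs. f (xs ! 0) (xs ! 1)" n] assms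
  by (auto simp: numeral_2_eq_2)

lemma total_rec_Suc: "total_rec n a \<Longrightarrow> total_rec n (\<lambda>xs. Suc (a xs))"
  by (rule total_rec_comp1[of Suc]) (simp_all add: total_rec_def partrec.succ[simplified])

lemma total_rec_const: "total_rec n (\<lambda>xs. c)"
proof (induction c)
  case 0
  show ?case by (simp add: total_rec_def partrec.zero)
next
  case (Suc c)
  then show ?case by (rule total_rec_Suc)
qed

text \<open>Primitive recursion with one parameter, already composed with arbitrary \<open>a\<close>
  and \<open>p\<close>, so that closure proofs only have to name \<open>z\<close> and
  \<open>s\<close>.\<close>

lemma total_rec_rec_nat:
  assumes z: "total_rec 1 (\<lambda>xs. z (xs ! 0))"
    and s: "total_rec 3 (\<lambda>xs. s (xs ! 0) (xs ! 1) (xs ! 2))"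
    and a: "total_rec n a" and p: "total_rec n p"
  shows "total_rec n (\<lambda>xs. rec_nat (z (p xs)) (\<lambda>k v. s k v (p xs)) (a xs))"
proof -
  let ?z = "\<lambda>xs. Some (z (xs ! 0))" and ?s = "\<lambda>xs. Some (s (xs ! 0) (xs ! 1) (xs ! 2))"
  have "partrec (1 + 1) (\<lambda>xs. rec_nat (?z (tl xs))
      (\<lambda>k r. case r of None \<Rightarrow> None | Some v \<Rightarrow> ?s (k # v # tl xs)) (hd xs))"
    by (rule partrec.prim) (use z s in \<open>simp_all add: total_rec_def numeral_3_eq_3\<close>)
  \<comment> \<open>The recursion never meets \<open>None\<close>, so the option-valued recursion of
    \<open>partrec.prim\<close> is the total one.\<close>
  moreover have "rec_nat (?z ys) (\<lambda>k r. case r of None \<Rightarrow> None | Some v \<Rightarrow> ?s (k # v # ys)) k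
      = Some (rec_nat (z (ys ! 0)) (\<lambda>k v. s k v (ys ! 0)) k)" for ys k
    by (induction k) simp_all
  ultimately have "partrec 2 (\<lambda>xs. Some (rec_nat (z (tl xs ! 0)) (\<lambda>k v. s k v (tl xs ! 0)) (hd xs)))"
    by (simp add: numeral_2_eq_2)
  then have "total_rec 2 (\<lambda>xs. rec_nat (z (xs ! 1)) (\<lambda>k v. s k v (xs ! 1)) (xs ! 0))"
    unfolding total_rec_def
    by (rule partrec.cong) (auto simp: numeral_2_eq_2 length_Suc_conv)
  then show ?thesis
    by (rule total_rec_comp2[where f = "\<lambda>a p. rec_nat (z p) (\<lambda>k v. s k v p) a", OF _ a p])
qed

section \<open>Arithmetic and case distinction\<close>

lemma total_rec_add:
  assumes "total_rec n a" "total_rec n b"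
  shows "total_rec n (\<lambda>xs. a xs + b xs)"
proof -
  have "total_rec n (\<lambda>xs. rec_nat (b xs) (\<lambda>k v. Suc v) (a xs))"
    by (rule total_rec_rec_nat[where p = b and z = "\<lambda>x. x" and s = "\<lambda>k v p. Suc v"])
      (auto intro!: total_rec_nth total_rec_Suc assms)
  moreover have "rec_nat y (\<lambda>k v. Suc v) x = x + y" for x y
    by (induction x) simp_all
  ultimately show ?thesis by simp
qed

lemma total_rec_pred:
  assumes "total_rec n a"
  shows "total_rec n (\<lambda>xs. a xs - 1)"
proof -
  have "total_rec n (\<lambda>xs. rec_nat 0 (\<lambda>k v. k) (a xs))"
    by (rule total_rec_rec_nat[where p = a and z = "\<lambda>_. 0" and s = "\<lambda>k v p. k"])
      (auto intro!: total_rec_nth total_rec_const assms)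
  moreover have "rec_nat 0 (\<lambda>k v. k) x = x - 1" for x
    by (cases x) simp_all
  ultimately show ?thesis by simp
qed

lemma total_rec_diff:
  assumes "total_rec n a" "total_rec n b"
  shows "total_rec n (\<lambda>xs. a xs - b xs)"
proof -
  have "total_rec n (\<lambda>xs. rec_nat (a xs) (\<lambda>k v. v - 1) (b xs))"
    by (rule total_rec_rec_nat[where p = a and z = "\<lambda>x. x" and s = "\<lambda>k v p. v - 1"])
      (intro total_rec_pred total_rec_nth assms; simp)+
  moreover have "rec_nat x (\<lambda>k v. v - 1) y = x - y" for x y
    by (induction y) simp_all
  ultimately show ?thesis by simp
qed

lemma total_rec_mult:
  assumes "total_rec n a" "total_rec n b"
  shows "total_rec n (\<lambda>xs. a xs * b xs)"
proof -
  have "total_rec n (\<lambda>xs. rec_nat 0 (\<lambda>k v. v + b xs) (a xs))"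
    by (rule total_rec_rec_nat[where p = b and z = "\<lambda>_. 0" and s = "\<lambda>k v p. v + p"])
      (auto intro!: total_rec_nth total_rec_const total_rec_add assms)
  moreover have "rec_nat 0 (\<lambda>k v. v + y) x = x * y" for x y :: nat
    by (induction x) simp_all
  ultimately show ?thesis by simp
qed

lemma total_rec_If:
  assumes "total_rec n a" "total_rec n b" "total_rec n c" "total_rec n d"
  shows "total_rec n (\<lambda>xs. if a xs = b xs then c xs else d xs)"
proof -
  \<comment> \<open>By truncated subtraction \<open>e xs\<close> is 1 if \<open>a xs = b xs\<close>
    and 0 otherwise, so it selects the branch arithmetically.\<close>
  define e where "e xs = 1 - ((a xs - b xs) + (b xs - a xs))" for xs
  have "total_rec n (\<lambda>xs. e xs * c xs + (1 - e xs) * d xs)"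
    unfolding e_def
    by (intro total_rec_add total_rec_mult total_rec_diff total_rec_const assms)
  then show ?thesis
    by (rule total_rec_cong) (auto simp: e_def)
qed

lemma total_rec_triangle:
  assumes "total_rec n a"
  shows "total_rec n (\<lambda>xs. triangle (a xs))"
proof -
  have "total_rec n (\<lambda>xs. rec_nat 0 (\<lambda>k v. v + Suc k) (a xs))"
    by (rule total_rec_rec_nat[where p = a and z = "\<lambda>_. 0" and s = "\<lambda>k v p. v + Suc k"])
      (auto intro!: total_rec_nth total_rec_const total_rec_add total_rec_Suc assms)
  moreover have "rec_nat 0 (\<lambda>k v. v + Suc k) x = triangle x" for x
    by (induction x) simp_all
  ultimately show ?thesis by simp
qed

lemma total_rec_prod_encode:
  assumes "total_rec n a" "total_rec n b"
  shows "total_rec n (\<lambda>xs. prod_encode (a xs, b xs))"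
  unfolding prod_encode_def prod.case
  by (intro total_rec_add total_rec_triangle assms)

section \<open>Computable inverse of the Cantor pairing\<close>

definition pfst :: "nat \<Rightarrow> nat" where "pfst z = fst (prod_decode z)"
definition psnd :: "nat \<Rightarrow> nat" where "psnd z = snd (prod_decode z)"

lemma pfst_prod_encode [simp]: "pfst (prod_encode (x, y)) = x"
  and psnd_prod_encode [simp]: "psnd (prod_encode (x, y)) = y"
  and prod_encode_pfst_psnd [simp]: "prod_encode (pfst z, psnd z) = z"
  by (simp_all add: pfst_def psnd_def)

text \<open>The antidiagonal of the Cantor pairing on which \<open>z\<close> lies. Counting upwards,
  the index grows exactly when the next triangular number is reached, which is a primitive
  recursion.\<close>

definition diagonal_index :: "nat \<Rightarrow> nat" where
  "diagonal_index z = rec_nat 0 (\<lambda>k v. if Suc k = triangle (Suc v) then Suc v else v) z"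

lemma diagonal_index_bounds:
  "triangle (diagonal_index z) \<le> z \<and> z < triangle (Suc (diagonal_index z))"
  by (induction z) (auto simp: diagonal_index_def)

text \<open>\<open>z\<close> is the triangular number of \<open>pfst z + psnd z\<close> plus an
  offset at most that sum. Since \<open>triangle\<close> is monotone, the bounds on
  \<open>diagonal_index z\<close> admit only one index.\<close>

lemma diagonal_index_eq: "diagonal_index z = pfst z + psnd z"
proof -
  have mono: "triangle m \<le> triangle n" if "m \<le> n" for m n
    using that by (induction rule: dec_induct) auto
  have z: "z = triangle (pfst z + psnd z) + pfst z"
    using prod_encode_pfst_psnd[of z] by (simp add: prod_encode_def)
  show ?thesis
  proof (rule linorder_cases)
    assume "diagonal_index z < pfst z + psnd z"
    then show ?thesis
      using mono[of "Suc (diagonal_index z)" "pfst z + psnd z"] z diagonal_index_bounds[of z] by linarith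
  next
    assume "pfst z + psnd z < diagonal_index z"
    then show ?thesis
      using mono[of "Suc (pfst z + psnd z)" "diagonal_index z"] z diagonal_index_bounds[of z] by simp
  qed
qed

lemma total_rec_diagonal_index:
  assumes "total_rec n a"
  shows "total_rec n (\<lambda>xs. diagonal_index (a xs))"
  unfolding diagonal_index_def
  by (rule total_rec_rec_nat[where p = a and z = "\<lambda>_. 0"
        and s = "\<lambda>k v p. if Suc k = triangle (Suc v) then Suc v else v"])
    (auto intro!: total_rec_nth total_rec_const total_rec_If total_rec_triangle total_rec_Suc assms
      simp del: triangle_Suc)

lemma pfst_eq: "pfst z = z - triangle (diagonal_index z)"
  using prod_encode_pfst_psnd[of z] by (simp add: prod_encode_def diagonal_index_eq)

lemma psnd_eq: "psnd z = diagonal_index z - pfst z"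
  by (simp add: diagonal_index_eq)

lemma total_rec_pfst:
  assumes "total_rec n a"
  shows "total_rec n (\<lambda>xs. pfst (a xs))"
  unfolding pfst_eq by (intro total_rec_diff total_rec_triangle total_rec_diagonal_index assms)

lemma total_rec_psnd:
  assumes "total_rec n a"
  shows "total_rec n (\<lambda>xs. psnd (a xs))"
  unfolding psnd_eq by (intro total_rec_diff total_rec_diagonal_index total_rec_pfst assms)

lemmas total_rec_intros = total_rec_nth total_rec_Suc total_rec_const total_rec_add total_rec_pred
  total_rec_diff total_rec_mult total_rec_If total_rec_prod_encode total_rec_pfst total_rec_psnd


section \<open>Reversing coded lists\<close>

definition list_cons :: "nat \<Rightarrow> nat \<Rightarrow> nat" where
  "list_cons x c = Suc (prod_encode (x, c))"

definition list_hd :: "nat \<Rightarrow> nat" where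
  "list_hd c = pfst (c - 1)"

definition list_drop :: "nat \<Rightarrow> nat \<Rightarrow> nat" where
  "list_drop k c = rec_nat c (\<lambda>_ v. psnd (v - 1)) k"

text \<open>Consing the entries from the front one after another reverses them. The length is passed
  as a counter, which keeps the recursion primitive.\<close>

definition list_rev_take :: "nat \<Rightarrow> nat \<Rightarrow> nat" where
  "list_rev_take k c = rec_nat 0 (\<lambda>j v. list_cons (list_hd (list_drop j c)) v) k"

lemma list_cons_list_encode: "list_cons x (list_encode xs) = list_encode (x # xs)"
  by (simp add: list_cons_def)

lemma list_hd_list_encode: "xs \<noteq> [] \<Longrightarrow> list_hd (list_encode xs) = hd xs"
  by (cases xs) (simp_all add: list_hd_def)

lemma list_drop_list_encode:
  "k \<le> length xs \<Longrightarrow> list_drop k (list_encode xs) = list_encode (drop k xs)"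
proof (induction k)
  case 0
  then show ?case by (simp add: list_drop_def)
next
  case (Suc k)
  then have "list_drop (Suc k) (list_encode xs) = psnd (list_encode (drop k xs) - 1)"
    by (simp add: list_drop_def)
  also have "drop k xs = xs ! k # drop (Suc k) xs"
    using Suc.prems by (simp add: Cons_nth_drop_Suc)
  finally show ?case by simp
qed

lemma list_rev_take_list_encode:
  "k \<le> length xs \<Longrightarrow> list_rev_take k (list_encode xs) = list_encode (rev (take k xs))"
proof (induction k)
  case 0
  then show ?case by (simp add: list_rev_take_def)
next
  case (Suc k)
  then have "list_rev_take (Suc k) (list_encode xs)
      = list_cons (list_hd (list_encode (drop k xs))) (list_encode (rev (take k xs)))"
    by (simp add: list_rev_take_def list_drop_list_encode)
  also have "\<dots> = list_encode (xs ! k # rev (take k xs))"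
    using Suc.prems by (simp add: list_hd_list_encode list_cons_list_encode hd_drop_conv_nth
        del: list_encode.simps)
  finally show ?case
    using Suc.prems by (simp add: take_Suc_conv_app_nth)
qed

lemma total_rec_list_cons:
  "total_rec n a \<Longrightarrow> total_rec n b \<Longrightarrow> total_rec n (\<lambda>xs. list_cons (a xs) (b xs))"
  unfolding list_cons_def by (intro total_rec_intros)

lemma total_rec_list_hd: "total_rec n a \<Longrightarrow> total_rec n (\<lambda>xs. list_hd (a xs))"
  unfolding list_hd_def by (intro total_rec_intros)

lemma total_rec_list_drop:
  assumes "total_rec n a" "total_rec n b"
  shows "total_rec n (\<lambda>xs. list_drop (a xs) (b xs))"
  unfolding list_drop_def
  by (rule total_rec_rec_nat[where z = "\<lambda>x. x" and p = b and s = "\<lambda>k v p. psnd (v - 1)"])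
    (intro total_rec_intros assms; simp)+

lemma total_rec_list_rev_take:
  assumes "total_rec n a" "total_rec n b"
  shows "total_rec n (\<lambda>xs. list_rev_take (a xs) (b xs))"
  unfolding list_rev_take_def
  by (rule total_rec_rec_nat[where z = "\<lambda>x. 0" and p = b
        and s = "\<lambda>j v p. list_cons (list_hd (list_drop j p)) v"])
    (intro total_rec_intros total_rec_list_cons total_rec_list_hd total_rec_list_drop assms; simp)+


section \<open>The recursion theorem\<close>

lemma total_computable_iff: "(\<lambda>x. Some (f x)) \<in> \<R> \<longleftrightarrow> total_rec 1 (\<lambda>xs. f (xs ! 0))"
  by (simp add: total_computable_def partial_computable_def total_rec_def)

lemma acceptable_partrec:
  assumes "acceptable_numbering \<phi>"
  shows "partrec 2 (\<lambda>xs. \<phi> (xs ! 0) (xs ! 1))"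
  using assms by (simp add: acceptable_numbering_def)

lemma acceptable_smn:
  assumes "acceptable_numbering \<phi>" "partrec 2 (\<lambda>xs. \<psi> (xs ! 0) (xs ! 1))"
  obtains c where "total_rec 1 (\<lambda>xs. c (xs ! 0))" "\<And>e. \<phi> (c e) = \<psi> e"
  using assms unfolding acceptable_numbering_def total_computable_iff by blast

lemma acceptable_index:
  assumes "acceptable_numbering \<phi>" "partrec 1 (\<lambda>xs. f (xs ! 0))"
  obtains e where "\<phi> e = f"
proof -
  have "f \<in> range \<phi>"
    using assms by (simp add: acceptable_numbering_def partial_computable_def)
  then show thesis using that by auto
qed

text \<open>Kleene's argument: \<open>d x\<close> is an index of the function whose index is the
  value \<open>\<phi> x x\<close>. For an index \<open>v\<close> of \<open>c\<close> after
  \<open>d\<close>, the numbers \<open>d v\<close> and \<open>c (d v)\<close> then index the same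
  function.\<close>

theorem recursion_theorem:
  assumes acc: "acceptable_numbering \<phi>" and \<psi>: "partrec 2 (\<lambda>xs. \<psi> (xs ! 0) (xs ! 1))"
  obtains e where "\<phi> e = \<psi> e"
proof -
  define \<chi> where "\<chi> x z = (case \<phi> x x of None \<Rightarrow> None | Some y \<Rightarrow> \<phi> y z)" for x z
  obtain c where c: "total_rec 1 (\<lambda>xs. c (xs ! 0))" "\<And>e. \<phi> (c e) = \<psi> e"
    using acceptable_smn[OF acc \<psi>] by blast
  let ?g = "\<lambda>xs. \<phi> (xs ! 0) (xs ! 0)"
  have g: "partrec 2 ?g"
    using partrec_comp_total[of "[\<lambda>xs. xs ! 0, \<lambda>xs. xs ! 0]" "\<lambda>xs. \<phi> (xs ! 0) (xs ! 1)" 2]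
      acceptable_partrec[OF acc]
    by (auto simp: numeral_2_eq_2 intro: total_rec_nth)
  \<comment> \<open>\<open>\<phi> x x\<close> may diverge, so composition with the divergence guard
    is needed here.\<close>
  let ?gs = "[?g, \<lambda>xs. Some (xs ! 1)]" and ?f = "\<lambda>xs. \<phi> (xs ! 0) (xs ! 1)"
  have "partrec 2 (\<lambda>xs. if \<exists>g\<in>set ?gs. g xs = None then None else ?f (map (\<lambda>g. the (g xs)) ?gs))"
    by (rule partrec.comp) (use g acceptable_partrec[OF acc] partrec.proj[of 1 2]
      in \<open>auto simp: numeral_2_eq_2\<close>)
  then have "partrec 2 (\<lambda>xs. \<chi> (xs ! 0) (xs ! 1))"
    by (rule partrec.cong) (auto simp: \<chi>_def)
  then obtain d where d: "total_rec 1 (\<lambda>xs. d (xs ! 0))" "\<And>x. \<phi> (d x) = \<chi> x"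
    using acceptable_smn[OF acc] by blast
  have "total_rec 1 (\<lambda>xs. c (d (xs ! 0)))"
    by (rule total_rec_comp1[OF c(1) d(1)])
  then obtain v where v: "\<phi> v = (\<lambda>x. Some (c (d x)))"
    using acceptable_index[OF acc, of "\<lambda>x. Some (c (d x))"] by (auto simp: total_rec_def)
  \<comment> \<open>\<open>\<phi> (d v)\<close> is \<open>\<chi> v\<close>, which is
    \<open>\<phi> (c (d v))\<close> because \<open>\<phi> v v\<close> yields
    \<open>c (d v)\<close>.\<close>
  have "\<phi> (d v) = \<psi> (d v)"
    using c d v by (auto simp: \<chi>_def)
  then show thesis by (rule that)
qed


section \<open>The separating class\<close>

text \<open>Nonemptiness ensures that every text shows a datum from which the index can be
  read.\<close>

definition self_indexed :: "(nat \<Rightarrow> nat \<rightharpoonup> nat) \<Rightarrow> nat set set" where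
  "self_indexed \<phi> = {C_set \<phi> e | e. C_index \<phi> e \<and> C_set \<phi> e \<noteq> {} \<and> (\<forall>z\<in>C_set \<phi> e. pfst z = e)}"

lemma C_set_in_REC:
  assumes "acceptable_numbering \<phi>" "C_index \<phi> e"
  shows "C_set \<phi> e \<in> REC"
proof -
  have "(\<lambda>x. Some (if x \<in> C_set \<phi> e then 1 else 0)) = \<phi> e"
  proof
    fix x
    have "\<phi> e x = Some 0 \<or> \<phi> e x = Some 1"
      using assms(2) by (simp add: C_index_def)
    then show "Some (if x \<in> C_set \<phi> e then 1 else 0) = \<phi> e x"
      by (auto simp: C_set_def)
  qed
  moreover have "\<phi> e \<in> \<P>"
    using assms(1) by (auto simp: acceptable_numbering_def)
  ultimately show ?thesis
    by (simp add: REC_def total_computable_def)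
qed

text \<open>The source of members: by the recursion theorem, a set of pairs marked by the nonzero
  values of \<open>f e\<close> can carry its own index as first component. The condition at 0 makes
  it nonempty.\<close>

lemma self_indexed_member:
  assumes acc: "acceptable_numbering \<phi>"
    and P: "total_rec 2 (\<lambda>xs. f (xs ! 0) (xs ! 1))"
    and "\<And>e. f e 0 \<noteq> 0"
  obtains e where "{prod_encode (e, x) | x. f e x \<noteq> 0} \<in> self_indexed \<phi>"
proof -
  \<comment> \<open>For every \<open>e\<close>, \<open>\<psi> e\<close> takes only the values 0 and
    1 and accepts only pairs with first component \<open>e\<close>, so any fixed point refers to
    itself as required.\<close>
  define \<psi> where
    "\<psi> e z = (if pfst z = e then if f e (psnd z) = 0 then 0 else 1 else 0 :: nat)" for e z
  have "total_rec 2 (\<lambda>xs. \<psi> (xs ! 0) (xs ! 1))"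
    unfolding \<psi>_def by (intro total_rec_intros total_rec_comp2[OF P]) simp_all
  then obtain e where e: "\<phi> e = (\<lambda>z. Some (\<psi> e z))"
    using recursion_theorem[OF acc, of "\<lambda>e z. Some (\<psi> e z)"] by (auto simp: total_rec_def)
  have "C_index \<phi> e"
    by (simp add: C_index_def e \<psi>_def)
  moreover have set: "C_set \<phi> e = {prod_encode (e, x) | x. f e x \<noteq> 0}"
  proof -
    have "\<psi> e z = 1 \<longleftrightarrow> (\<exists>x. z = prod_encode (e, x) \<and> f e x \<noteq> 0)" for z
      using prod_encode_pfst_psnd[of z] unfolding \<psi>_def by (metis pfst_prod_encode psnd_prod_encode zero_neq_one)
    then show ?thesis by (auto simp: C_set_def e)
  qed
  moreover have "prod_encode (e, 0) \<in> C_set \<phi> e" "\<forall>z\<in>C_set \<phi> e. pfst z = e"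
    using assms(3)[of e] by (auto simp: set)
  ultimately have "C_set \<phi> e \<in> self_indexed \<phi>"
    unfolding self_indexed_def by blast
  then show thesis using that set by simp
qed

text \<open>On a text for a member, each datum yields its index \<open>e\<close> and each pause
  yields \<open>?\<close>, so the only change is from \<open>?\<close> to \<open>e\<close>.\<close>

lemma self_indexed_learnable:
  assumes acc: "acceptable_numbering \<phi>"
  shows "self_indexed \<phi> \<in> learnable_classes unrestricted \<R> Td (CInd \<phi> \<sqinter>\<^sub>r Ex_C \<phi>)"
proof -
  \<comment> \<open>The code 0 is a pause on input and \<open>?\<close> on output; subtracting 1
    strips the input coding and \<open>Suc\<close> marks a hypothesis.\<close>
  define h where "h x = (if x = 0 then 0 else Suc (pfst (x - 1)))" for x
  let ?h = "\<lambda>x. Some (h x)"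
  have "total_rec 1 (\<lambda>xs. h (xs ! 0))"
    unfolding h_def by (intro total_rec_intros) simp_all
  then have h: "?h \<in> \<R>" by (simp add: total_computable_iff)
  have "learns unrestricted Td (CInd \<phi> \<sqinter>\<^sub>r Ex_C \<phi>) ?h (C_set \<phi> e)"
    if e: "C_index \<phi> e" "C_set \<phi> e \<noteq> {}" "\<forall>z\<in>C_set \<phi> e. pfst z = e" for e
  proof -
    have "CInd \<phi> (Td ?h T) T \<and> Ex_C \<phi> (Td ?h T) T" if T: "content T = C_set \<phi> e" for T
    proof -
      have Td: "Td ?h T n = Some (if \<exists>i<n. T i \<noteq> Pause then Hypothesis e else No_New_Hypothesis)" for n
      proof (induction n)
        case (Suc n)
        show ?case
        proof (cases "T n")
          case Pause
          then show ?thesis using Suc by (auto simp: h_def less_Suc_eq)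
        next
          case (Datum z)
          then have "z \<in> C_set \<phi> e"
            unfolding T[symmetric] content_def by (metis mem_Collect_eq rangeI)
          then show ?thesis using Datum e(3) by (auto simp: h_def)
        qed
      qed simp
      obtain z where "Datum z \<in> range T"
        using e(2) unfolding T[symmetric] content_def by blast
      then obtain i where i: "T i = Datum z" by auto
      \<comment> \<open>Position \<open>i + 1\<close> is the first whose hypothesis takes
        \<open>T i\<close> into account.\<close>
      have "Td ?h T n = Some (Hypothesis e)" if "Suc i \<le> n" for n
        using that i by (auto simp: Td intro!: exI[of _ i])
      then have "Ex_C \<phi> (Td ?h T) T"
        unfolding Ex_C_def using e(1) T by (intro exI[of _ "Suc i"]) (auto simp del: Td.simps)
      then show ?thesis using e(1) by (simp add: CInd_def Td)
    qed
    then show ?thesis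
      by (simp add: learns_def unrestricted_def restriction_conj_def text_for_def)
  qed
  then have "\<forall>L\<in>self_indexed \<phi>. learns unrestricted Td (CInd \<phi> \<sqinter>\<^sub>r Ex_C \<phi>) ?h L"
    by (auto simp: self_indexed_def)
  moreover have "self_indexed \<phi> \<subseteq> REC"
    using C_set_in_REC[OF acc] by (auto simp: self_indexed_def)
  ultimately show ?thesis
    using h by (auto simp: learnable_classes_def)
qed


section \<open>Diagonalization\<close>

fun symbol_decode :: "nat \<Rightarrow> symbol" where
  "symbol_decode 0 = Pause"
| "symbol_decode (Suc x) = Datum x"

lemma symbol_encode_decode [simp]: "symbol_encode (symbol_decode c) = c"
  by (cases c) simp_all

text \<open>Carries \<open>CInd\<close>, a condition on texts, over to every input code of the
  learner.\<close>

lemma sequence_encode_surj: obtains T n where "c = sequence_encode (initial_segment T n)"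
proof -
  let ?xs = "map symbol_decode (list_decode c)"
  have "initial_segment (\<lambda>i. ?xs ! i) (length ?xs) = ?xs"
    unfolding initial_segment_def by (rule map_nth)
  then have "c = sequence_encode (initial_segment (\<lambda>i. ?xs ! i) (length ?xs))"
    by (simp add: sequence_encode_def comp_def)
  then show thesis by (rule that)
qed

text \<open>
  \<open>d c x\<close> is the prediction about \<open>x\<close> of the learner's hypothesis on the sequence with code \<open>c\<close>.
  The code of \<open>T[n]\<close> is built by consing, hence in reverse order.
\<close>

definition diag_symbol :: "(nat \<Rightarrow> nat \<Rightarrow> nat) \<Rightarrow> nat \<Rightarrow> nat \<Rightarrow> nat \<Rightarrow> nat" where
  "diag_symbol d n v e = (if n = 0 then Suc (prod_encode (e, n)) else
     if d (list_rev_take n v) (prod_encode (e, n)) = 1 then 0 else Suc (prod_encode (e, n)))"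

text \<open>Keeping the whole past in one number turns the course-of-values recursion defining the
  text into a primitive one with parameter \<open>e\<close>.\<close>

definition diag_history :: "(nat \<Rightarrow> nat \<Rightarrow> nat) \<Rightarrow> nat \<Rightarrow> nat \<Rightarrow> nat" where
  "diag_history d n e = rec_nat 0 (\<lambda>k v. list_cons (diag_symbol d k v e) v) n"

definition diag_code :: "(nat \<Rightarrow> nat \<Rightarrow> nat) \<Rightarrow> nat \<Rightarrow> nat \<Rightarrow> nat" where
  "diag_code d e n = diag_symbol d n (diag_history d n e) e"

definition diag_text :: "(nat \<Rightarrow> nat \<Rightarrow> nat) \<Rightarrow> nat \<Rightarrow> text_seq" where
  "diag_text d e n = symbol_decode (diag_code d e n)"

lemma total_rec_diag_code:
  assumes d: "total_rec 2 (\<lambda>xs. d (xs ! 0) (xs ! 1))"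
  shows "total_rec 2 (\<lambda>xs. diag_code d (xs ! 0) (xs ! 1))"
proof -
  have sym: "total_rec n (\<lambda>xs. diag_symbol d (a xs) (b xs) (c xs))"
    if "total_rec n a" "total_rec n b" "total_rec n c" for n a b c
    unfolding diag_symbol_def
    by (intro total_rec_intros total_rec_comp2[OF d] total_rec_list_rev_take that)
  have "total_rec 2 (\<lambda>xs. diag_history d (xs ! 1) (xs ! 0))"
    unfolding diag_history_def
    by (rule total_rec_rec_nat[where z = "\<lambda>x. 0" and p = "\<lambda>xs. xs ! 0"
          and s = "\<lambda>k v p. list_cons (diag_symbol d k v p) v"])
      (intro total_rec_intros total_rec_list_cons sym; simp)+
  then show ?thesis
    unfolding diag_code_def by (intro sym total_rec_intros) simp_all
qed

lemma diag_history_eq: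
  "diag_history d n e = list_encode (rev (map (diag_code d e) [0..<n]))"
proof (induction n)
  case 0
  then show ?case by (simp add: diag_history_def)
next
  case (Suc n)
  have "diag_history d (Suc n) e = list_cons (diag_code d e n) (diag_history d n e)"
    by (simp add: diag_history_def diag_code_def)
  then show ?case by (simp add: Suc list_cons_list_encode del: list_encode.simps)
qed

text \<open>The reversal in the history and the one in \<open>list_rev_take\<close> cancel, so the
  construction queries the learner's true input.\<close>

lemma sequence_encode_diag_text:
  "sequence_encode (initial_segment (diag_text d e) n) = list_rev_take n (diag_history d n e)"
  by (simp add: diag_history_eq list_rev_take_list_encode sequence_encode_def initial_segment_def
      diag_text_def comp_def)

lemma diag_code_0: "diag_code d e 0 = Suc (prod_encode (e, 0))"
  by (simp add: diag_code_def diag_symbol_def)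

lemma diag_code_pos:
  "n > 0 \<Longrightarrow> diag_code d e n =
    (if d (sequence_encode (initial_segment (diag_text d e) n)) (prod_encode (e, n)) = 1
     then 0 else Suc (prod_encode (e, n)))"
  by (simp add: diag_code_def diag_symbol_def sequence_encode_diag_text)

text \<open>Position \<open>n\<close> can contribute only the pair of \<open>e\<close> and
  \<open>n\<close>, so a pair withheld there appears nowhere else.\<close>

lemma content_diag_text:
  "content (diag_text d e) = {prod_encode (e, n) | n. diag_code d e n \<noteq> 0}"
proof -
  have "diag_code d e n = 0 \<or> diag_code d e n = Suc (prod_encode (e, n))" for n
    by (auto simp: diag_code_def diag_symbol_def)
  then have "diag_text d e n = Datum z \<longleftrightarrow> z = prod_encode (e, n) \<and> diag_code d e n \<noteq> 0" for n z
    unfolding diag_text_def by (metis nat.distinct(1) symbol.distinct(1) symbol.inject symbol_decode.simps)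
  moreover have "content T = {z. \<exists>n. T n = Datum z}" for T
    unfolding content_def image_def by (auto dest: sym)
  ultimately show ?thesis by simp
qed

text \<open>\<open>CInd\<close> on all texts makes every answer of \<open>h\<close> either
  \<open>?\<close> or a C-index. Evaluating hypotheses is thus total computable, and so is the
  diagonal text.\<close>

lemma self_indexed_not_learnable:
  assumes acc: "acceptable_numbering \<phi>"
  shows "self_indexed \<phi> \<notin> learnable_classes (CInd \<phi>) \<P> G (Bc_C \<phi>)"
proof
  assume "self_indexed \<phi> \<in> learnable_classes (CInd \<phi>) \<P> G (Bc_C \<phi>)"
  then obtain h where "h \<in> \<P>"
    and learns: "\<And>L. L \<in> self_indexed \<phi> \<Longrightarrow> learns (CInd \<phi>) G (Bc_C \<phi>) h L"
    by (auto simp: learnable_classes_def)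
  \<comment> \<open>The global condition is stated inside \<open>learns\<close>, so a member is
    needed to extract it.\<close>
  have "self_indexed \<phi> \<noteq> {}"
    using self_indexed_member[OF acc, of "\<lambda>_ _. 1"] total_rec_const by auto
  then have CInd: "CInd \<phi> (G h T) T" for T
    using learns by (auto simp: learns_def)
  have h_cases: "h c = Some 0 \<or> (\<exists>q. h c = Some (Suc q) \<and> C_index \<phi> q)" for c
  proof -
    obtain T n where c: "c = sequence_encode (initial_segment T n)"
      by (rule sequence_encode_surj)
    have *: "hypothesis_decode r = No_New_Hypothesis \<longleftrightarrow> r = 0"
      "hypothesis_decode r = Hypothesis q \<longleftrightarrow> r = Suc q" for r q
      by (cases r; simp)+
    show ?thesis
      using CInd[of T] unfolding CInd_def G_def c by (auto simp: * dest!: spec[of _ n])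
  qed
  have "total_rec 1 (\<lambda>xs. the (h (xs ! 0)))"
  proof -
    have "Some (the (h c)) = h c" for c using h_cases[of c] by auto
    then show ?thesis using \<open>h \<in> \<P>\<close> by (simp add: total_rec_def partial_computable_def)
  qed
  note total_h = total_rec_comp1[of "\<lambda>c. the (h c)", OF this]
  \<comment> \<open>An index of the constant 0 function replaces the answer \<open>?\<close>, so
    that a prediction exists on every code.\<close>
  obtain q0 where q0: "\<phi> q0 = (\<lambda>x. Some 0)"
    using acceptable_index[OF acc, of "\<lambda>x. Some 0"] partrec.zero by blast
  define s where "s c = (if the (h c) = 0 then q0 else the (h c) - 1)" for c
  define d where "d c x = the (\<phi> (s c) x)" for c x
  have d_total: "Some (d c x) = \<phi> (s c) x" for c x
  proof -
    have "C_index \<phi> (s c)" using h_cases[of c] q0 by (auto simp: s_def C_index_def)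
    then have "\<phi> (s c) x \<noteq> None" by (auto simp: C_index_def dest!: spec[of _ x])
    then show ?thesis by (auto simp: d_def)
  qed
  have "total_rec 2 (\<lambda>xs. s (xs ! 0))"
    unfolding s_def by (intro total_rec_intros total_h) simp_all
  then have "partrec 2 (\<lambda>xs. \<phi> (s (xs ! 0)) (xs ! 1))"
    using partrec_comp_total[of "[\<lambda>xs. s (xs ! 0), \<lambda>xs. xs ! 1]" "\<lambda>xs. \<phi> (xs ! 0) (xs ! 1)" 2]
      acceptable_partrec[OF acc]
    by (auto simp: numeral_2_eq_2 intro: total_rec_nth)
  then have "total_rec 2 (\<lambda>xs. d (xs ! 0) (xs ! 1))"
    by (simp add: total_rec_def d_total)
  then have "total_rec 2 (\<lambda>xs. diag_code d (xs ! 0) (xs ! 1))"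
    by (rule total_rec_diag_code)
  then obtain e where "{prod_encode (e, n) | n. diag_code d e n \<noteq> 0} \<in> self_indexed \<phi>"
    by (rule self_indexed_member[OF acc]) (simp add: diag_code_0)
  then have "content (diag_text d e) \<in> self_indexed \<phi>"
    by (simp add: content_diag_text)
  then have "Bc_C \<phi> (G h (diag_text d e)) (diag_text d e)"
    using learns by (auto simp: learns_def text_for_def)
  then obtain n0 where n0: "\<And>n. n \<ge> n0 \<Longrightarrow> \<exists>q. G h (diag_text d e) n = Some (Hypothesis q) \<and>
      C_set \<phi> q = content (diag_text d e)"
    unfolding Bc_C_def by blast
  \<comment> \<open>Position 0 always carries a datum; the contradiction needs a positive position
    beyond \<open>n0\<close>.\<close>
  define n where "n = Suc n0"
  define c where "c = sequence_encode (initial_segment (diag_text d e) n)"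
  obtain q where q: "map_option hypothesis_decode (h c) = Some (Hypothesis q)"
      "C_set \<phi> q = content (diag_text d e)"
    using n0[of n] by (auto simp: n_def G_def c_def)
  \<comment> \<open>Convergence rules out \<open>?\<close> here, so \<open>s c\<close> decodes the
    learner's own hypothesis and not the default.\<close>
  then have "s c = q" using h_cases[of c] by (auto simp: s_def)
  \<comment> \<open>The hypothesis contains the pair iff the prediction is 1, whereas the text
    contains it iff the prediction is not 1.\<close>
  then have "d c (prod_encode (e, n)) = 1 \<longleftrightarrow> prod_encode (e, n) \<in> C_set \<phi> q"
    using d_total[of c "prod_encode (e, n)"] by (auto simp: C_set_def)
  also have "\<dots> \<longleftrightarrow> diag_code d e n \<noteq> 0"
    by (auto simp: q(2) content_diag_text)
  also have "\<dots> \<longleftrightarrow> d c (prod_encode (e, n)) \<noteq> 1"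
    by (simp add: diag_code_pos c_def n_def)
  finally show False by simp
qed

theorem theorem10:
  fixes \<phi> :: "nat \<Rightarrow> nat \<rightharpoonup> nat"
  assumes "acceptable_numbering \<phi>"
  shows "learnable_classes unrestricted \<R> Td (CInd \<phi> \<sqinter>\<^sub>r Ex_C \<phi>)
         - learnable_classes (CInd \<phi>) \<P> G (Bc_C \<phi>) \<noteq> {}"
  using self_indexed_learnable[OF assms] self_indexed_not_learnable[OF assms] by blast

end
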